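(* Let $(X,d)$ be a (nonempty) complete metric space that is uniformly $\varepsilon$-chainable on balls for every $\varepsilon>0$ and such that $(\mathcal K(X),d_H)$ is $\varepsilon$-chainable for every $\varepsilon>0$. Let $\Lambda$ be a (nonempty) compact metric space, $p$ a Borel probability measure on $\Lambda$, and $w:\Lambda\times X\to X$ a weakly$^*$ hyperbolic iterated function system, and let $K$ be the global attractor of $w$. Then there exists a unique invariant measure $\nu\in\mathcal M(X)$ (i.e. $T_p(\nu)=\nu$) such that $\mathrm{supp}(\nu)\subset K$; and $\mathrm{supp}(\nu)=K$ if $p(U)>0$ for each nonempty open $U\subset\Lambda$. Furthermore, if $\mu\in\mathcal M(X)$ has compact support, then $T_p^n(\mu)\to\nu$ in the Hutchinson metric as $n\to\infty$.
   Context: An iterated function system (IFS) is a continuous map $w:\Lambda\times X\to X$; put $w_\lambda(x):=w(\lambda,x)$ and $w_{\lambda_1\dots\lambda_n}:=w_{\lambda_1}\circ\cdots\circ w_{\lambda_n}$. $\Omega:=\Lambda^{\mathbb N}$ is the space of infinite words $\sigma=(\sigma_1,\sigma_2,\dots)$. $w$ is weakly$^*$ hyperbolic if for all $x,y\in X$ and $\sigma\in\Omega$, $\lim_{n\to\infty}d(w_{\sigma_1\dots\sigma_n}(x),w_{\sigma_1\dots\sigma_n}(y))=0$, with convergence uniform in $\Omega$ and locally uniform in $X$ in the following sense: there exists $\eta>0$ such that for every $\varepsilon>0$ there exists $n_0=n_0(\varepsilon)$ such that if $n\ge n_0$ then $d(w_{\sigma_1\dots\sigma_n}(x),w_{\sigma_1\dots\sigma_n}(y))<\varepsilon$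 for all $\sigma\in\Omega$ and all $x,y\in X$ with $d(x,y)<\eta$. $\mathcal K(X)$ is the family of nonempty compact subsets of $X$ with the Hausdorff metric $d_H$, and $\mathcal F:\mathcal K(X)\to\mathcal K(X)$ is $\mathcal F(A)=\bigcup_{\lambda\in\Lambda}w_\lambda(A)$. The global attractor of $w$ is the set $K\in\mathcal K(X)$ such that $\mathcal F^n(B)\to K$ in the Hausdorff metric for every $B\in\mathcal K(X)$; under the present hypotheses on $\mathcal K(X)$ and $w$ it exists, is unique, and satisfies $\mathcal F(K)=K$. A finite sequence $x_0=x,x_1,\dots,x_n=y$ of points in a metric space $(M,\rho)$ with $\rho(x_i,x_{i+1})<\varepsilon$ for $i=0,\dots,n-1$ is an $\varepsilon$-chain joining $x$ and $y$, with $n+1$ elements. $M$ is $\varepsilon$-chainable if any two points are joined by an $\varepsilon$-chain. $M$ is uniformly $\varepsilon$-chainable on balls if for every ball $B(a,r)\subset M$ there is an integer $k=k(a,r,\varepsilon)$ such that any $x,y\in B(a,r)$ are joined by an $\varepsilon$-chain in $M$ with at most $k$ elements. $\mathcal M(X)$ is the set of Borel probability measures $\mu$ on $X$ with $\int_X f\,d\mu<+\infty$ for every $f\in\mathrm{Lip}_1(X;\mathbb R)=\{f:X\to\mathbb R:|f(x)-f(y)|\le d(x,y)\ \forall x,y\}$; if $X$ is not separable, only measures with separable support (concentrated on that support) are considered. The Hutchinson metric is $H(\nu,\mu)=\sup\{|\int f\,d\nu-\int f\,d\mu|:f\in\mathrm{Lip}_1(X;\mathbb R)\}$. The transfer operator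 is $T_p(\mu)(B)=\int_\Lambda\mu(w_\lambda^{-1}(B))\,dp(\lambda)$ for Borel $B\subset X$. *)

theory Defs
  imports "HOL-Probability.Probability"
begin

subsection \<open>Chains\<close>

text \<open>
  Chains are stated for a carrier \<open>M\<close> with a distance function \<open>\<rho>\<close>, because they are used both
  for the points of a metric space and for its compact subsets with the Hausdorff metric. A chain
  is the nonempty list of its elements, so its number of elements is the length of the list.
\<close>

definition eps_chain :: "'m set \<Rightarrow> ('m \<Rightarrow> 'm \<Rightarrow> real) \<Rightarrow> real \<Rightarrow> 'm \<Rightarrow> 'm \<Rightarrow> 'm list \<Rightarrow> bool" where
  "eps_chain M \<rho> \<epsilon> x y xs \<longleftrightarrow>
     xs \<noteq> [] \<and> set xs \<subseteq> M \<and> hd xs = x \<and> last xs = y \<and>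
     (\<forall>i. Suc i < length xs \<longrightarrow> \<rho> (xs ! i) (xs ! Suc i) < \<epsilon>)"

definition chainable :: "'m set \<Rightarrow> ('m \<Rightarrow> 'm \<Rightarrow> real) \<Rightarrow> real \<Rightarrow> bool" where
  "chainable M \<rho> \<epsilon> \<longleftrightarrow> (\<forall>x\<in>M. \<forall>y\<in>M. \<exists>xs. eps_chain M \<rho> \<epsilon> x y xs)"

definition uniformly_chainable_on_balls :: "'m set \<Rightarrow> ('m \<Rightarrow> 'm \<Rightarrow> real) \<Rightarrow> real \<Rightarrow> bool" where
  "uniformly_chainable_on_balls M \<rho> \<epsilon> \<longleftrightarrow>
     (\<forall>a\<in>M. \<forall>r>0. \<exists>k::nat. \<forall>x\<in>M. \<forall>y\<in>M. \<rho> a x < r \<and> \<rho> a y < r \<longrightarrow>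
        (\<exists>xs. eps_chain M \<rho> \<epsilon> x y xs \<and> length xs \<le> k))"


subsection \<open>Compact subsets and the Hausdorff metric\<close>

definition nonempty_compacts :: "'a::metric_space set set" where
  "nonempty_compacts = {A. compact A \<and> A \<noteq> {}}"

definition hausdorff_dist :: "'a::metric_space set \<Rightarrow> 'a set \<Rightarrow> real" where
  "hausdorff_dist A B = max (SUP a\<in>A. infdist a B) (SUP b\<in>B. infdist b A)"


subsection \<open>Iterated function systems\<close>

definition IFS :: "('l::metric_space \<Rightarrow> 'a::metric_space \<Rightarrow> 'a) \<Rightarrow> bool" where
  "IFS w \<longleftrightarrow> continuous_on UNIV (\<lambda>(l, x). w l x)"

text \<open>
  With words indexed from 0, the following is the map \<open>w (\<sigma> 0) \<circ> w (\<sigma> 1) \<circ> \<dots> \<circ> w (\<sigma> (n - 1))\<close>.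
\<close>

definition word_map :: "('l \<Rightarrow> 'a \<Rightarrow> 'a) \<Rightarrow> (nat \<Rightarrow> 'l) \<Rightarrow> nat \<Rightarrow> 'a \<Rightarrow> 'a" where
  "word_map w \<sigma> n = foldr w (map \<sigma> [0..<n])"

definition weakly_star_hyperbolic :: "('l \<Rightarrow> 'a::metric_space \<Rightarrow> 'a) \<Rightarrow> bool" where
  "weakly_star_hyperbolic w \<longleftrightarrow>
     (\<forall>x y \<sigma>. (\<lambda>n. dist (word_map w \<sigma> n x) (word_map w \<sigma> n y)) \<longlonglongrightarrow> 0) \<and>
     (\<exists>\<eta>>0. \<forall>\<epsilon>>0. \<exists>n0. \<forall>n\<ge>n0. \<forall>\<sigma> x y.
        dist x y < \<eta> \<longrightarrow> dist (word_map w \<sigma> n x) (word_map w \<sigma> n y) < \<epsilon>)"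

definition hutchinson_operator :: "('l \<Rightarrow> 'a \<Rightarrow> 'a) \<Rightarrow> 'a set \<Rightarrow> 'a set" where
  "hutchinson_operator w A = (\<Union>l. w l ` A)"

definition global_attractor :: "('l \<Rightarrow> 'a::metric_space \<Rightarrow> 'a) \<Rightarrow> 'a set \<Rightarrow> bool" where
  "global_attractor w K \<longleftrightarrow>
     K \<in> nonempty_compacts \<and>
     (\<forall>B\<in>nonempty_compacts.
        (\<lambda>n. hausdorff_dist ((hutchinson_operator w ^^ n) B) K) \<longlonglongrightarrow> 0)"


subsection \<open>Measures\<close>

definition borel_prob_measure :: "'a::topological_space measure \<Rightarrow> bool" where
  "borel_prob_measure \<mu> \<longleftrightarrow> prob_space \<mu> \<and> sets \<mu> = sets borel"

definition supp :: "'a::topological_space measure \<Rightarrow> 'a set" where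
  "supp \<mu> = {x. \<forall>U. open U \<and> x \<in> U \<longrightarrow> measure \<mu> U > 0}"

definition Lip1 :: "('a::metric_space \<Rightarrow> real) set" where
  "Lip1 = {f. 1-lipschitz_on UNIV f}"

text \<open>
  Since \<open>Lip1\<close> is closed under absolute values, finiteness of the integrals of all its members
  is integrability of all its members.
\<close>

definition measures_M :: "'a::metric_space measure set" where
  "measures_M = {\<mu>. borel_prob_measure \<mu> \<and> (\<forall>f\<in>Lip1. integrable \<mu> f) \<and>
     (\<not> separable_space (euclidean :: 'a topology) \<longrightarrow>
        separable_space (top_of_set (supp \<mu>)) \<and> measure \<mu> (supp \<mu>) = 1)}"

text \<open>
  For \<open>\<nu>\<close> and \<open>\<mu>\<close> in \<open>measures_M\<close> the set whose supremum is taken is nonempty and bounded: fixing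
  a point \<open>a\<close>, every element is at most \<open>(\<integral>x. dist a x \<partial>\<nu>) + (\<integral>x. dist a x \<partial>\<mu>)\<close>.
\<close>

definition hutchinson_dist :: "'a::metric_space measure \<Rightarrow> 'a measure \<Rightarrow> real" where
  "hutchinson_dist \<nu> \<mu> = (SUP f\<in>Lip1. \<bar>(\<integral>x. f x \<partial>\<nu>) - (\<integral>x. f x \<partial>\<mu>)\<bar>)"

definition transfer_operator ::
    "'l measure \<Rightarrow> ('l \<Rightarrow> 'a::topological_space \<Rightarrow> 'a) \<Rightarrow> 'a measure \<Rightarrow> 'a measure" where
  "transfer_operator p w \<mu> =
     measure_of UNIV (sets borel) (\<lambda>B. \<integral>\<^sup>+ l. emeasure \<mu> (w l -` B) \<partial>p)"

end

theory Submission
  imports Defs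
begin

text \<open>
  Every infinite word \<open>\<sigma>\<close> has a code, the limit of \<open>w (\<sigma> 0) \<circ> \<dots> \<circ> w (\<sigma> (n - 1))\<close> at any point, and the
  invariant measure is the law of the code of a random word whose letters are independent with law
  \<open>p\<close>. Prefixing one more letter \<open>l\<close> to a word applies \<open>w l\<close> to its code, and it preserves the law of
  the random word; this is the invariance.

  The code exists because word maps contract bounded sets uniformly. Two points of a ball are joined
  by an \<open>\<eta>\<close>-chain of bounded length, long words make the image of each link as short as desired, and
  the triangle inequality adds the links up (\<open>uniform_contraction\<close>). The orbit of a compact set is
  bounded, since the iterates of the Hutchinson operator approach \<open>K\<close> (\<open>bounded_orbits\<close>). Lengthening
  a word on the right amounts to evaluating it at another point of that bounded orbit, so the values
  along a word form a Cauchy sequence, and they converge to the code uniformly in the word and in the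
  starting point from a compact set (\<open>word_map_uniform_limit\<close>).

  The iterate \<open>T\<^sup>n \<mu>\<close> is the law of the first \<open>n\<close> letters of the random word acting on an independent
  point with law \<open>\<mu>\<close> (\<open>transfer_operator_iterate\<close>). It is thus realised on the same probability space as
  the code, at a distance that tends to zero uniformly if \<open>\<mu>\<close> is concentrated on a compact set, and the integrals of a 1-Lipschitz function
  differ by no more than this distance (\<open>integral_iterate_dist_le\<close>). Convergence in the Hutchinson
  metric follows; applied to an invariant measure on \<open>K\<close>, whose iterates are constant, it gives uniqueness,
  because a measure is determined by its integrals of Lipschitz functions (\<open>measure_eqI_Lip1\<close>).

  If \<open>p\<close> charges every nonempty open set, the support of the invariant measure is mapped into itself by
  every \<open>w l\<close>. A nonempty closed set with this property contains all iterates of the Hutchinson operator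
  on one of its points, hence their limit \<open>K\<close> (\<open>K_subset_invariant\<close>).
\<close>

section \<open>Countable dense sets and supports\<close>

lemma compact_countable_dense:
  fixes A :: "'a::metric_space set"
  assumes "compact A"
  shows "\<exists>D. countable D \<and> D \<subseteq> A \<and> A \<subseteq> closure D"
proof -
  have "\<exists>k. finite k \<and> k \<subseteq> A \<and> A \<subseteq> (\<Union>x\<in>k. ball x (1 / real (Suc n)))" for n
  proof -
    have "A \<subseteq> (\<Union>x\<in>A. ball x (1 / real (Suc n)))" by auto
    from compactE_image[OF assms _ this] show ?thesis by (metis open_ball)
  qed
  then obtain k where k: "\<And>n. finite (k n)" "\<And>n. k n \<subseteq> A"
      "\<And>n. A \<subseteq> (\<Union>x\<in>k n. ball x (1 / real (Suc n)))"
    by metis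
  have "A \<subseteq> closure (\<Union>n. k n)"
  proof
    fix x assume x: "x \<in> A"
    show "x \<in> closure (\<Union>n. k n)"
      unfolding closure_approachable
    proof (intro allI impI)
      fix e :: real assume "e > 0"
      then obtain n where n: "1 / real (Suc n) < e"
        using nat_approx_posE by (metis)
      from k(3)[of n] x obtain d where "d \<in> k n" "dist d x < 1 / real (Suc n)" by auto
      then show "\<exists>y\<in>\<Union>n. k n. dist y x < e" using n by (meson UNIV_I UN_I less_trans)
    qed
  qed
  moreover have "countable (\<Union>n. k n)" using k(1) by (auto intro: countable_finite)
  ultimately show ?thesis using k(2) by blast
qed

lemma compact_imp_separable_space:
  fixes A :: "'a::metric_space set"
  assumes "compact A"
  shows "separable_space (top_of_set A)"
proof -
  obtain D where "countable D" "D \<subseteq> A" "A \<subseteq> closure D"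
    using compact_countable_dense[OF assms] by blast
  then show ?thesis
    unfolding separable_space_def
    by (intro exI[of _ D]) (auto simp: closure_of_subtopology Int_absorb1)
qed

text \<open>
  The complement of the support is a union of open null sets, possibly an uncountable one. On \<open>A\<close> the
  balls with centre in \<open>D\<close> and rational radius suffice; they are countably many, so those of measure
  zero can be discarded simultaneously, and every remaining point of \<open>A\<close> is in the support.
\<close>

lemma AE_in_supp:
  fixes \<mu> :: "'a::metric_space measure"
  assumes "finite_measure \<mu>" and sets: "sets \<mu> = sets borel"
    and "countable D" and dense: "A \<subseteq> closure D" and ae: "AE x in \<mu>. x \<in> A"
  shows "AE x in \<mu>. x \<in> supp \<mu>"
proof -
  interpret finite_measure \<mu> by fact
  have "AE x in \<mu>. measure \<mu> (ball d q) = 0 \<longrightarrow> x \<notin> ball d q" for d q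
  proof (cases "measure \<mu> (ball d q) = 0")
    case True
    then have "ball d q \<in> null_sets \<mu>"
      by (simp add: null_sets_def emeasure_eq_measure sets)
    from AE_not_in[OF this] show ?thesis by auto
  qed simp
  then have "AE x in \<mu>. \<forall>d\<in>D. \<forall>q\<in>\<rat>. measure \<mu> (ball d q) = 0 \<longrightarrow> x \<notin> ball d q"
    by (simp add: AE_ball_countable \<open>countable D\<close> countable_rat)
  then show ?thesis using ae
  proof eventually_elim
    case (elim x)
    show "x \<in> supp \<mu>"
      unfolding supp_def
    proof (intro CollectI allI impI)
      fix U assume "open U \<and> x \<in> U"
      then obtain e where e: "e > 0" "ball x e \<subseteq> U" and U: "open U"
        using openE by blast
      have "x \<in> closure D" using elim dense by blast
      then obtain d where d: "d \<in> D" "dist d x < e / 2"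
        using e by (metis closure_approachable half_gt_zero)
      obtain q where q: "q \<in> \<rat>" "dist d x < q" "q < e / 2"
        using Rats_dense_in_real[OF d(2)] by blast
      have "ball d q \<subseteq> U"
      proof
        fix y assume "y \<in> ball d q"
        then have "dist x y < e"
          using dist_triangle[of x y d] q by (simp add: dist_commute)
        then show "y \<in> U" using e by auto
      qed
      then have "measure \<mu> (ball d q) \<le> measure \<mu> U"
        using U by (intro finite_measure_mono) (auto simp: sets)
      moreover have "measure \<mu> (ball d q) \<noteq> 0" using elim d q by auto
      ultimately show "measure \<mu> U > 0"
        using measure_nonneg[of \<mu> "ball d q"] by linarith
    qed
  qed
qed

lemma closed_supp: "closed (supp \<mu>)"
  unfolding closed_def
proof (subst open_subopen, intro ballI)
  fix x assume "x \<in> - supp \<mu>"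
  then obtain U where "open U" "x \<in> U" "\<not> measure \<mu> U > 0" by (auto simp: supp_def)
  then show "\<exists>T. open T \<and> x \<in> T \<and> T \<subseteq> - supp \<mu>"
    by (intro exI[of _ U]) (auto simp: supp_def)
qed

lemma AE_in_supp_measures_M:
  fixes \<mu> :: "'a::metric_space measure"
  assumes "\<mu> \<in> measures_M"
  shows "AE x in \<mu>. x \<in> supp \<mu>"
proof -
  have \<mu>: "prob_space \<mu>" "sets \<mu> = sets borel"
    using assms by (auto simp: measures_M_def borel_prob_measure_def)
  interpret prob_space \<mu> by fact
  show ?thesis
  proof (cases "separable_space (euclidean :: 'a topology)")
    case True
    then obtain D :: "'a set" where "countable D" "closure D = UNIV"
      by (auto simp: separable_space_def)
    then show ?thesis
      using \<mu> by (intro AE_in_supp[of _ D UNIV] finite_measure_axioms) auto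
  next
    case False
    then have "prob (supp \<mu>) = 1" using assms by (simp add: measures_M_def)
    then show ?thesis using closed_supp[of \<mu>] \<mu> by (subst (asm) prob_eq_1) auto
  qed
qed

section \<open>Measures are determined by their integrals of Lipschitz functions\<close>

lemma Lip1_iff: "f \<in> Lip1 \<longleftrightarrow> (\<forall>x y. \<bar>f x - f y\<bar> \<le> dist x y)"
  by (auto simp: Lip1_def lipschitz_on_def dist_real_def)

lemma Lip1_measurable:
  assumes "f \<in> Lip1"
  shows "f \<in> borel_measurable borel"
  using assms unfolding Lip1_def
  by (auto intro: borel_measurable_continuous_onI lipschitz_on_continuous_on)

text \<open>
  The indicator function of a closed set is a bounded pointwise limit of multiples of 1-Lipschitz
  functions of the distance to the set, and closed sets generate the Borel sets.
\<close>

lemma measure_eqI_Lip1: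
  fixes \<mu> \<nu> :: "'a::metric_space measure"
  assumes "borel_prob_measure \<mu>" "borel_prob_measure \<nu>"
    and eq: "\<And>f. f \<in> Lip1 \<Longrightarrow> (\<integral>x. f x \<partial>\<mu>) = (\<integral>x. f x \<partial>\<nu>)"
  shows "\<mu> = \<nu>"
proof -
  interpret M: prob_space \<mu> using assms(1) by (simp add: borel_prob_measure_def)
  interpret N: prob_space \<nu> using assms(2) by (simp add: borel_prob_measure_def)
  have sets: "sets \<mu> = sets borel" "sets \<nu> = sets borel"
    using assms by (auto simp: borel_prob_measure_def)
  have closed_eq: "measure \<mu> C = measure \<nu> C" if C: "closed C" for C
  proof (cases "C = {}")
    case False
    \<comment> \<open>The multiple \<open>real (Suc n) * f n\<close> is 1 on \<open>C\<close> and 0 at distance \<open>1 / Suc n\<close> from it.\<close>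
    define f where "f n x = max 0 (1 / real (Suc n) - infdist x C)" for n x
    have f: "f n \<in> Lip1" for n
      unfolding Lip1_iff f_def
    proof (intro allI)
      fix x y
      show "\<bar>max 0 (1 / real (Suc n) - infdist x C) - max 0 (1 / real (Suc n) - infdist y C)\<bar> \<le> dist x y"
        using infdist_triangle_abs[of x C y] by (simp add: max_def abs_if split: if_splits)
    qed
    have bound: "\<bar>real (Suc n) * f n x\<bar> \<le> 1" for n x
    proof -
      have "0 \<le> f n x" "f n x \<le> 1 / real (Suc n)"
        using infdist_nonneg[of x C] by (auto simp: f_def)
      then show ?thesis by (simp add: field_simps abs_mult)
    qed
    have lim: "(\<lambda>n. real (Suc n) * f n x) \<longlonglongrightarrow> indicat_real C x" for x
    proof (cases "x \<in> C")
      case True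
      then have "real (Suc n) * f n x = 1" for n by (simp add: f_def field_simps)
      then show ?thesis using True by (simp)
    next
      case x: False
      then have pos: "infdist x C > 0"
        using C False infdist_pos_not_in_closed by blast
      obtain n0 where n0: "1 / real (Suc n0) < infdist x C"
        using pos nat_approx_posE by metis
      have "real (Suc n) * f n x = 0" if "n \<ge> n0" for n
      proof -
        have "1 / real (Suc n) \<le> 1 / real (Suc n0)"
          using that by (simp add: frac_le)
        then show ?thesis using n0 by (simp add: f_def)
      qed
      then have "eventually (\<lambda>n. real (Suc n) * f n x = 0) sequentially"
        using eventually_sequentially by blast
      then show ?thesis using x by (simp add: tendsto_eventually)
    qed
    have conv: "(\<lambda>n. \<integral>x. real (Suc n) * f n x \<partial>P) \<longlonglongrightarrow> measure P C"
      if P: "prob_space P" "sets P = sets borel" for P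
    proof -
      interpret prob_space P by fact
      note P(2)[measurable_cong]
      have [measurable]: "f n \<in> borel_measurable borel" "C \<in> sets borel" for n
        using Lip1_measurable[OF f] C by auto
      have "(\<lambda>n. \<integral>x. real (Suc n) * f n x \<partial>P) \<longlonglongrightarrow> (\<integral>x. indicat_real C x \<partial>P)"
        by (rule integral_dominated_convergence[where w = "\<lambda>_. 1"])
          (use bound lim in auto)
      moreover have "space P = UNIV" using sets_eq_imp_space_eq[OF P(2)] by simp
      ultimately show ?thesis by simp
    qed
    have "(\<integral>x. real (Suc n) * f n x \<partial>\<mu>) = (\<integral>x. real (Suc n) * f n x \<partial>\<nu>)" for n
      using eq[OF f] by simp
    then show ?thesis
      using conv[OF M.prob_space_axioms sets(1)] conv[OF N.prob_space_axioms sets(2)]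
      by (metis (no_types, lifting) LIMSEQ_unique ext)
  qed simp
  show ?thesis
  proof (rule measure_eqI_generator_eq[where E = "Collect closed" and \<Omega> = UNIV and A = "\<lambda>_. UNIV"])
    show "Int_stable (Collect closed)" by (auto simp: Int_stable_def)
    show "sets \<mu> = sigma_sets UNIV (Collect closed)" "sets \<nu> = sigma_sets UNIV (Collect closed)"
      by (simp_all add: sets borel_eq_closed)
    show "emeasure \<mu> X = emeasure \<nu> X" if "X \<in> Collect closed" for X
      using closed_eq[of X] that by (simp add: M.emeasure_eq_measure N.emeasure_eq_measure)
  qed auto
qed

section \<open>Open sets of a product with a separable factor\<close>

text \<open>
  The product of two Borel \<open>\<sigma>\<close>-algebras can be smaller than the Borel \<open>\<sigma>\<close>-algebra of the product. It is
  not if one factor is separable: an open set is then a countable union of rectangles, one for each ball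
  of a countable base, whose other side is the largest open set that fits.
\<close>

lemma open_in_sets_pair_borel:
  fixes W :: "('l::metric_space \<times> 'x::topological_space) set"
  assumes "countable D" "closure D = (UNIV :: 'l set)" "open W"
  shows "W \<in> sets (borel \<Otimes>\<^sub>M borel)"
proof -
  define V where "V d q = \<Union>{V :: 'x set. open V \<and> ball d q \<times> V \<subseteq> W}" for d :: 'l and q :: real
  have "W = (\<Union>d\<in>D. \<Union>q\<in>\<rat>. ball d q \<times> V d q)"
  proof (intro equalityI subsetI)
    fix z assume "z \<in> W"
    then obtain A B where AB: "open A" "open B" "z \<in> A \<times> B" "A \<times> B \<subseteq> W"
      using open_prod_elim[OF \<open>open W\<close>] by metis
    then obtain l x where z: "z = (l, x)" "l \<in> A" "x \<in> B" by blast
    obtain e where e: "e > 0" "ball l e \<subseteq> A" using AB z openE by blast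
    obtain d where d: "d \<in> D" "dist d l < e / 2"
      using e assms(2) by (metis UNIV_I closure_approachable half_gt_zero)
    obtain q where q: "q \<in> \<rat>" "dist d l < q" "q < e / 2"
      using Rats_dense_in_real[OF d(2)] by blast
    have "ball d q \<subseteq> A"
    proof
      fix y assume "y \<in> ball d q"
      then have "dist l y < e"
        using dist_triangle[of l y d] q by (simp add: dist_commute)
      then show "y \<in> A" using e by auto
    qed
    then have "B \<subseteq> V d q" using AB unfolding V_def by blast
    then show "z \<in> (\<Union>d\<in>D. \<Union>q\<in>\<rat>. ball d q \<times> V d q)"
      using z d q by auto
  qed (auto simp: V_def)
  moreover have "open (V d q)" for d q by (auto simp: V_def)
  ultimately show ?thesis
    using \<open>countable D\<close> countable_rat
    by (auto intro!: sets.countable_UN' pair_measureI)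
qed

section \<open>Word maps and the Hutchinson operator\<close>

lemma word_map_0 [simp]: "word_map w \<sigma> 0 x = x"
  by (simp add: word_map_def)

lemma word_map_Suc:
  "word_map w \<sigma> (Suc n) x = w (\<sigma> 0) (word_map w (\<lambda>i. \<sigma> (Suc i)) n x)"
proof -
  have "map \<sigma> [0..<Suc n] = \<sigma> 0 # map (\<lambda>i. \<sigma> (Suc i)) [0..<n]"
    by (simp add: upt_conv_Cons map_Suc_upt[symmetric] o_def del: upt_Suc)
  then show ?thesis by (simp add: word_map_def del: upt_Suc)
qed

lemma word_map_add:
  "word_map w \<sigma> (m + n) x = word_map w \<sigma> m (word_map w (\<lambda>i. \<sigma> (m + i)) n x)"
  by (induction m arbitrary: \<sigma>) (simp_all add: word_map_Suc)

lemma word_map_in_hutchinson_iterate: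
  "x \<in> B \<Longrightarrow> word_map w \<sigma> n x \<in> (hutchinson_operator w ^^ n) B"
  by (induction n arbitrary: \<sigma>) (auto simp: word_map_Suc hutchinson_operator_def)

lemma bdd_above_infdist:
  assumes "compact A"
  shows "bdd_above ((\<lambda>x. infdist x B) ` A)"
proof -
  have "compact ((\<lambda>x. infdist x B) ` A)"
    by (intro compact_continuous_image assms continuous_intros)
  then show ?thesis by (simp add: compact_imp_bounded bounded_imp_bdd_above)
qed

lemma infdist_le_hausdorff_dist:
  assumes "compact A" "x \<in> A"
  shows "infdist x B \<le> hausdorff_dist A B"
  unfolding hausdorff_dist_def
  by (rule max.coboundedI1, rule cSUP_upper[OF assms(2) bdd_above_infdist[OF assms(1)]])

lemma infdist_le_hausdorff_dist':
  assumes "compact B" "x \<in> B"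
  shows "infdist x A \<le> hausdorff_dist A B"
  unfolding hausdorff_dist_def
  by (rule max.coboundedI2, rule cSUP_upper[OF assms(2) bdd_above_infdist[OF assms(1)]])

lemma dist_image_chain_le:
  fixes f :: "'a::metric_space \<Rightarrow> 'b::metric_space"
  assumes f: "\<And>u v. dist u v < \<eta> \<Longrightarrow> dist (f u) (f v) \<le> \<delta>" and "\<delta> \<ge> 0"
    and "xs \<noteq> []" "\<And>i. Suc i < length xs \<Longrightarrow> dist (xs ! i) (xs ! Suc i) < \<eta>"
  shows "dist (f (hd xs)) (f (last xs)) \<le> real (length xs) * \<delta>"
  using assms(3,4)
proof (induction xs)
  case (Cons x xs)
  show ?case
  proof (cases xs)
    case Nil
    then show ?thesis using \<open>\<delta> \<ge> 0\<close> by simp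
  next
    case (Cons y ys)
    have "dist x y < \<eta>" using Cons.prems(2)[of 0] Cons by simp
    then have "dist (f x) (f y) \<le> \<delta>" by (rule f)
    moreover have "dist (f (hd xs)) (f (last xs)) \<le> real (length xs) * \<delta>"
      using Cons Cons.prems(2) by (intro Cons.IH) (auto, metis Suc_less_eq nth_Cons_Suc)
    ultimately show ?thesis
      using Cons dist_triangle[of "f x" "f (last xs)" "f y"] by (simp add: algebra_simps)
  qed
qed simp

section \<open>The coding map\<close>

locale attracting_ifs =
  fixes w :: "'l::metric_space \<Rightarrow> 'x::complete_space \<Rightarrow> 'x" and K :: "'x set"
  assumes chainable: "\<forall>\<epsilon>>0. uniformly_chainable_on_balls (UNIV :: 'x set) dist \<epsilon>"
    and compact_index: "compact (UNIV :: 'l set)"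
    and IFS: "IFS w"
    and hyperbolic: "weakly_star_hyperbolic w"
    and attractor: "global_attractor w K"
begin

lemma compact_K: "compact K" and K_nonempty: "K \<noteq> {}"
  using attractor by (auto simp: global_attractor_def nonempty_compacts_def)

lemma continuous_w: "continuous_on UNIV (w l)"
proof -
  have "continuous_on UNIV ((\<lambda>(l, x). w l x) \<circ> (\<lambda>x. (l, x)))"
    using IFS unfolding IFS_def
    by (intro continuous_on_compose continuous_intros) (auto intro: continuous_on_subset)
  then show ?thesis by (simp add: o_def)
qed

lemma hutchinson_iterate_compact:
  assumes "B \<in> nonempty_compacts"
  shows "(hutchinson_operator w ^^ n) B \<in> nonempty_compacts"
proof (induction n)
  case (Suc n)
  have "hutchinson_operator w A = (\<lambda>(l, x). w l x) ` (UNIV \<times> A)" for A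
    by (auto simp: hutchinson_operator_def)
  moreover have "compact ((\<lambda>(l, x). w l x) ` (UNIV \<times> A))" if "compact A" for A
    using IFS that compact_index unfolding IFS_def
    by (intro compact_continuous_image compact_Times) (auto intro: continuous_on_subset)
  ultimately show ?case using Suc by (auto simp: nonempty_compacts_def)
qed (use assms in simp)

lemma hausdorff_dist_iterate_tendsto:
  assumes "compact B" "B \<noteq> {}"
  shows "(\<lambda>n. hausdorff_dist ((hutchinson_operator w ^^ n) B) K) \<longlonglongrightarrow> 0"
  using attractor assms by (auto simp: global_attractor_def nonempty_compacts_def)

text \<open>
  All but finitely many iterates of the Hutchinson operator lie in the 1-neighbourhood of the compact
  set \<open>K\<close>, and the remaining ones are compact.
\<close>

lemma bounded_orbits:
  assumes "compact B"
  shows "bounded {word_map w \<sigma> n x | \<sigma> n x. x \<in> B}"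
proof (cases "B = {}")
  case False
  define F where "F n = (hutchinson_operator w ^^ n) B" for n
  have F: "compact (F n)" for n
    using hutchinson_iterate_compact[of B n] assms False by (auto simp: F_def nonempty_compacts_def)
  obtain N where N: "\<And>n. n \<ge> N \<Longrightarrow> hausdorff_dist (F n) K < 1"
    using order_tendstoD(2)[OF hausdorff_dist_iterate_tendsto[OF assms False], of 1]
    by (auto simp: F_def eventually_sequentially)
  have "bounded {x. infdist x K < 1}"
  proof -
    obtain a r where r: "\<And>x. x \<in> K \<Longrightarrow> dist a x \<le> r"
      using compact_imp_bounded[OF compact_K] by (auto simp: bounded_def)
    have "dist a y \<le> r + 1" if y: "infdist y K < 1" for y
    proof -
      obtain x where "x \<in> K" "dist y x < 1"
        using y K_nonempty cINF_less_iff[of K "dist y" 1]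
        by (auto simp: infdist_notempty)
      then show ?thesis using r[of x] dist_triangle[of a y x] by (simp add: dist_commute)
    qed
    then show ?thesis by (auto simp: bounded_def)
  qed
  moreover have "bounded (\<Union>n\<in>{..<N}. F n)"
    using F compact_imp_bounded by (intro bounded_UN) auto
  moreover have "{word_map w \<sigma> n x | \<sigma> n x. x \<in> B} \<subseteq> {x. infdist x K < 1} \<union> (\<Union>n\<in>{..<N}. F n)"
  proof
    fix y assume "y \<in> {word_map w \<sigma> n x | \<sigma> n x. x \<in> B}"
    then obtain n where n: "y \<in> F n"
      using word_map_in_hutchinson_iterate by (force simp: F_def)
    show "y \<in> {x. infdist x K < 1} \<union> (\<Union>n\<in>{..<N}. F n)"
    proof (cases "n < N")
      case False
      then show ?thesis
        using N[of n] infdist_le_hausdorff_dist[OF F n, of K] by simp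
    qed (use n in auto)
  qed
  ultimately show ?thesis by (meson bounded_Un bounded_subset)
qed simp

text \<open>
  The starting point from which codes are computed; by \<open>word_map_uniform_limit\<close> below every other point
  gives the same codes.
\<close>

definition base :: 'x where "base = undefined"

text \<open>
  The hypothesis of weak\<open>\<^sup>*\<close> hyperbolicity is uniform only for points at distance less than some \<open>\<eta>\<close>.
  Chains of bounded length extend it to all pairs of points of a bounded set.
\<close>

lemma uniform_contraction:
  assumes "bounded A" "e > 0"
  shows "\<exists>n0. \<forall>n\<ge>n0. \<forall>\<sigma>. \<forall>x\<in>A. \<forall>y\<in>A. dist (word_map w \<sigma> n x) (word_map w \<sigma> n y) < e"
proof -
  obtain \<eta> where "\<eta> > 0" and
    \<eta>: "\<forall>\<epsilon>>0. \<exists>n0. \<forall>n\<ge>n0. \<forall>\<sigma> x y.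
          dist x y < \<eta> \<longrightarrow> dist (word_map w \<sigma> n x) (word_map w \<sigma> n y) < \<epsilon>"
    using hyperbolic unfolding weakly_star_hyperbolic_def by (elim conjE exE)
  obtain r where "r > 0" "A \<subseteq> ball base r"
    using bounded_subset_ballD[OF assms(1)] by blast
  then have r: "dist base x < r" if "x \<in> A" for x
    using that by auto
  have "\<forall>r>0. \<exists>k. \<forall>x\<in>UNIV. \<forall>y\<in>UNIV. dist base x < r \<and> dist base y < r \<longrightarrow>
      (\<exists>xs. eps_chain UNIV dist \<eta> x y xs \<and> length xs \<le> k)"
    using chainable[rule_format, OF \<open>\<eta> > 0\<close>, unfolded uniformly_chainable_on_balls_def]
    by (rule bspec) simp
  from this[rule_format, OF \<open>r > 0\<close>] obtain k where k: "\<forall>x\<in>UNIV. \<forall>y\<in>UNIV.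
      dist base x < r \<and> dist base y < r \<longrightarrow>
      (\<exists>xs. eps_chain UNIV dist \<eta> x y xs \<and> length xs \<le> k)" ..
  \<comment> \<open>Chains have at most \<open>k\<close> elements; the divisor \<open>Suc k\<close> makes the total strictly less than \<open>e\<close>.\<close>
  define \<delta> where "\<delta> = e / real (Suc k)"
  have "\<delta> > 0" using \<open>e > 0\<close> by (simp add: \<delta>_def)
  obtain n0 where n0: "\<forall>n\<ge>n0. \<forall>\<sigma> x y.
      dist x y < \<eta> \<longrightarrow> dist (word_map w \<sigma> n x) (word_map w \<sigma> n y) < \<delta>"
    using \<eta>[rule_format, OF \<open>\<delta> > 0\<close>] ..
  have "dist (word_map w \<sigma> n x) (word_map w \<sigma> n y) < e"
    if "n \<ge> n0" and x: "x \<in> A" and y: "y \<in> A" for n \<sigma> x y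
  proof -
    obtain xs where xs: "eps_chain UNIV dist \<eta> x y xs" "length xs \<le> k"
      using k r[OF x] r[OF y] by blast
    have "dist (word_map w \<sigma> n (hd xs)) (word_map w \<sigma> n (last xs)) \<le> real (length xs) * \<delta>"
    proof (rule dist_image_chain_le[where \<eta> = \<eta>])
      show "dist (word_map w \<sigma> n u) (word_map w \<sigma> n v) \<le> \<delta>" if "dist u v < \<eta>" for u v
        using n0[rule_format, OF \<open>n \<ge> n0\<close> that] by (rule less_imp_le)
    qed (use \<open>\<delta> > 0\<close> xs(1) in \<open>simp_all add: eps_chain_def\<close>)
    also have "\<dots> < real (Suc k) * \<delta>"
      using xs(2) \<open>\<delta> > 0\<close> by (intro mult_strict_right_mono) simp_all
    also have "\<dots> = e" by (simp add: \<delta>_def)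
    finally show ?thesis using xs(1) by (simp add: eps_chain_def)
  qed
  then show ?thesis by blast
qed

definition code :: "(nat \<Rightarrow> 'l) \<Rightarrow> 'x" where
  "code \<sigma> = lim (\<lambda>n. word_map w \<sigma> n base)"

text \<open>
  Splitting a word of length \<open>n + m\<close> after \<open>n\<close> letters shows that its value at \<open>base\<close> is a value of the
  word of length \<open>n\<close> at a point of the orbit of \<open>base\<close>; orbits being bounded, \<open>uniform_contraction\<close>
  applies.
\<close>

lemma word_map_uniform_tail:
  assumes "compact B" "e > 0"
  shows "\<exists>n0. \<forall>n\<ge>n0. \<forall>\<sigma> m. \<forall>x\<in>B. dist (word_map w \<sigma> n x) (word_map w \<sigma> (n + m) base) < e"
proof -
  define A where "A = {word_map w \<sigma> n x | \<sigma> n x. x \<in> insert base B}"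
  have "bounded A" unfolding A_def using assms by (intro bounded_orbits) simp
  then obtain n0 where n0: "\<And>n \<sigma> x y. n \<ge> n0 \<Longrightarrow> x \<in> A \<Longrightarrow> y \<in> A \<Longrightarrow>
      dist (word_map w \<sigma> n x) (word_map w \<sigma> n y) < e"
    using uniform_contraction[OF _ \<open>e > 0\<close>] by metis
  have "x \<in> A" if "x \<in> B" for x
    unfolding A_def using that by (intro CollectI exI[of _ "\<lambda>_. undefined"] exI[of _ 0] exI[of _ x]) simp
  moreover have "word_map w \<sigma> m base \<in> A" for \<sigma> m unfolding A_def by blast
  ultimately show ?thesis using n0 by (intro exI[of _ n0]) (auto simp: word_map_add)
qed

lemma code_LIMSEQ: "(\<lambda>n. word_map w \<sigma> n base) \<longlonglongrightarrow> code \<sigma>"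
proof -
  have "Cauchy (\<lambda>n. word_map w \<sigma> n base)"
  proof (rule CauchyI')
    fix e :: real assume "e > 0"
    then obtain n0 where n0: "\<And>n m. n \<ge> n0 \<Longrightarrow>
        dist (word_map w \<sigma> n base) (word_map w \<sigma> (n + m) base) < e"
      using word_map_uniform_tail[of "{base}" e] by auto
    show "\<exists>M. \<forall>m\<ge>M. \<forall>n>m. dist (word_map w \<sigma> m base) (word_map w \<sigma> n base) < e"
      using n0 by (metis less_imp_add_positive)
  qed
  then show ?thesis
    unfolding code_def using Cauchy_convergent_iff convergent_LIMSEQ_iff by blast
qed

lemma word_map_uniform_limit:
  assumes "compact B" "e > 0"
  shows "\<exists>n0. \<forall>n\<ge>n0. \<forall>\<sigma>. \<forall>x\<in>B. dist (word_map w \<sigma> n x) (code \<sigma>) \<le> e"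
proof -
  obtain n0 where n0: "\<And>n \<sigma> m x. n \<ge> n0 \<Longrightarrow> x \<in> B \<Longrightarrow>
      dist (word_map w \<sigma> n x) (word_map w \<sigma> (n + m) base) < e"
    using word_map_uniform_tail[OF assms] by blast
  have "dist (word_map w \<sigma> n x) (code \<sigma>) \<le> e" if "n \<ge> n0" "x \<in> B" for n \<sigma> x
  proof (rule LIMSEQ_le_const2)
    have "(\<lambda>m. word_map w \<sigma> (m + n) base) \<longlonglongrightarrow> code \<sigma>"
      using code_LIMSEQ by (rule LIMSEQ_ignore_initial_segment)
    then show "(\<lambda>m. dist (word_map w \<sigma> n x) (word_map w \<sigma> (m + n) base))
        \<longlonglongrightarrow> dist (word_map w \<sigma> n x) (code \<sigma>)"
      by (intro tendsto_intros)
    show "\<exists>N. \<forall>m\<ge>N. dist (word_map w \<sigma> n x) (word_map w \<sigma> (m + n) base) \<le> e"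
      using n0[OF that] by (metis add.commute less_imp_le)
  qed
  then show ?thesis by blast
qed

lemma code_in_K: "code \<sigma> \<in> K"
proof -
  have "infdist (word_map w \<sigma> n base) K \<le> hausdorff_dist ((hutchinson_operator w ^^ n) {base}) K" for n
    using hutchinson_iterate_compact[of "{base}" n]
    by (intro infdist_le_hausdorff_dist word_map_in_hutchinson_iterate)
      (auto simp: nonempty_compacts_def)
  then have "infdist (code \<sigma>) K \<le> 0"
    by (intro LIMSEQ_le[OF tendsto_infdist[OF code_LIMSEQ] hausdorff_dist_iterate_tendsto[of "{base}"]]) auto
  then show ?thesis
    using compact_K K_nonempty infdist_nonneg[of "code \<sigma>" K]
    by (simp add: in_closed_iff_infdist_zero compact_imp_closed)
qed

text \<open>
  The new letter is applied last at every finite stage, and \<open>w l\<close>, being continuous, commutes with the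
  limit. This is what a composition order that adds later letters on the inside is good for.
\<close>

lemma code_case_nat: "code (case_nat l \<sigma>) = w l (code \<sigma>)"
proof (rule LIMSEQ_unique)
  show "(\<lambda>n. word_map w (case_nat l \<sigma>) (Suc n) base) \<longlonglongrightarrow> code (case_nat l \<sigma>)"
    using code_LIMSEQ by (rule LIMSEQ_Suc)
  have "(\<lambda>n. w l (word_map w \<sigma> n base)) \<longlonglongrightarrow> w l (code \<sigma>)"
    using continuous_on_tendsto_compose[OF continuous_w code_LIMSEQ] by simp
  then show "(\<lambda>n. word_map w (case_nat l \<sigma>) (Suc n) base) \<longlonglongrightarrow> w l (code \<sigma>)"
    by (simp add: word_map_Suc)
qed

text \<open>
  The iterates of the Hutchinson operator on a point of \<open>C\<close> stay in \<open>C\<close> and come arbitrarily close to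
  every point of \<open>K\<close>.
\<close>

lemma K_subset_invariant:
  assumes "closed C" "C \<noteq> {}" and inv: "\<And>l x. x \<in> C \<Longrightarrow> w l x \<in> C"
  shows "K \<subseteq> C"
proof
  fix x assume x: "x \<in> K"
  obtain c where c: "c \<in> C" using assms by blast
  define F where "F n = (hutchinson_operator w ^^ n) {c}" for n
  have F: "F n \<in> nonempty_compacts" for n
    unfolding F_def by (rule hutchinson_iterate_compact) (simp add: nonempty_compacts_def)
  have sub: "F n \<subseteq> C" for n
    unfolding F_def by (induction n) (use c inv in \<open>auto simp: hutchinson_operator_def\<close>)
  have "infdist x C \<le> hausdorff_dist (F n) K" for n
  proof -
    have "infdist x C \<le> infdist x (F n)"
      using F[of n] sub by (intro infdist_mono) (auto simp: nonempty_compacts_def)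
    also have "\<dots> \<le> hausdorff_dist (F n) K"
      using x compact_K by (rule infdist_le_hausdorff_dist'[rotated])
    finally show ?thesis .
  qed
  then have "infdist x C \<le> 0"
    using hausdorff_dist_iterate_tendsto[of "{c}"]
    by (intro LIMSEQ_le_const[where X = "\<lambda>n. hausdorff_dist (F n) K"]) (auto simp: F_def)
  then show "x \<in> C"
    using assms infdist_nonneg[of x C] by (simp add: in_closed_iff_infdist_zero)
qed

end

section \<open>The transfer operator\<close>

locale random_ifs = attracting_ifs w K
  for w :: "'l::metric_space \<Rightarrow> 'x::complete_space \<Rightarrow> 'x" and K +
  fixes p :: "'l measure"
  assumes p: "borel_prob_measure p"
begin

lemma sets_p [measurable_cong, simp]: "sets p = sets borel"
  using p by (simp add: borel_prob_measure_def)

lemma space_p [simp]: "space p = UNIV"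
  using sets_eq_imp_space_eq[OF sets_p] by simp

sublocale P: prob_space p
  using p by (simp add: borel_prob_measure_def)

sublocale W: sequence_space p
  by standard

lemma space_W [simp]: "space W.S = UNIV"
  by (simp add: space_PiM)

text \<open>
  The index space is compact, hence separable, so that continuity gives measurability for the product
  \<open>\<sigma>\<close>-algebra even if \<open>'x\<close> is not separable.
\<close>

lemma measurable_w: "(\<lambda>(l, x). w l x) \<in> borel_measurable (borel \<Otimes>\<^sub>M borel)"
proof (rule borel_measurableI)
  fix V :: "'x set" assume "open V"
  obtain D where D: "countable D" "closure D = (UNIV :: 'l set)"
    using compact_countable_dense[OF compact_index] by auto
  have "open ((\<lambda>(l, x). w l x) -` V)"
    using IFS \<open>open V\<close> by (simp add: IFS_def continuous_on_open_vimage)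
  from open_in_sets_pair_borel[OF D this]
  show "(\<lambda>(l, x). w l x) -` V \<inter> space (borel \<Otimes>\<^sub>M borel) \<in> sets (borel \<Otimes>\<^sub>M borel)"
    by (simp add: space_pair_measure)
qed

lemma measurable_w_comp [measurable (raw)]:
  assumes "f \<in> M \<rightarrow>\<^sub>M borel" "g \<in> borel_measurable M"
  shows "(\<lambda>x. w (f x) (g x)) \<in> borel_measurable M"
  using measurable_compose[OF measurable_Pair[OF assms] measurable_w] by simp

lemma measurable_word_map_comp:
  assumes "f \<in> M \<rightarrow>\<^sub>M W.S" "g \<in> borel_measurable M"
  shows "(\<lambda>x. word_map w (f x) n (g x)) \<in> borel_measurable M"
proof -
  have f: "(\<lambda>x. f x i) \<in> M \<rightarrow>\<^sub>M borel" for i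
    using measurable_compose[OF assms(1) measurable_component_singleton[of i UNIV "\<lambda>_. p"]]
    by (simp cong: measurable_cong_sets)
  have "(\<lambda>x. foldr w (map (f x) is) (g x)) \<in> borel_measurable M" for "is"
    by (induction "is") (use assms(2) in \<open>auto intro!: measurable_w_comp f\<close>)
  then show ?thesis by (simp add: word_map_def)
qed

lemma measurable_word_map [measurable]:
  "(\<lambda>(\<sigma>, x). word_map w \<sigma> n x) \<in> borel_measurable (W.S \<Otimes>\<^sub>M borel)"
  unfolding split_beta by (intro measurable_word_map_comp measurable_fst measurable_snd)

lemma measurable_code [measurable]: "code \<in> borel_measurable W.S"
  by (rule borel_measurable_LIMSEQ_metric[OF _ code_LIMSEQ])
    (auto intro: measurable_word_map_comp)

text \<open>
  The transfer operator moves a random point by a random independent map. In particular its defining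
  set function is a measure, which the construction by \<open>measure_of\<close> presupposes.
\<close>

lemma transfer_operator_eq_distr:
  assumes "borel_prob_measure \<mu>"
  shows "transfer_operator p w \<mu> = distr (p \<Otimes>\<^sub>M \<mu>) borel (\<lambda>(l, x). w l x)"
proof -
  have sets[measurable_cong]: "sets \<mu> = sets borel"
    using assms by (simp add: borel_prob_measure_def)
  have space: "space \<mu> = UNIV" using sets_eq_imp_space_eq[OF sets] by simp
  interpret prob_space \<mu> using assms by (simp add: borel_prob_measure_def)
  let ?D = "distr (p \<Otimes>\<^sub>M \<mu>) borel (\<lambda>(l, x). w l x)"
  have "?D = measure_of UNIV (sets borel) (emeasure ?D)"
    using measure_of_of_measure[of ?D] by simp
  also have "\<dots> = transfer_operator p w \<mu>"
    unfolding transfer_operator_def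
  proof (rule measure_of_eq)
    fix B :: "'x set" assume "B \<in> sigma_sets UNIV (sets borel)"
    then have B[measurable]: "B \<in> sets borel"
      using sets.sigma_sets_eq[of "borel :: 'x measure"] by simp
    let ?A = "(\<lambda>(l, x). w l x) -` B \<inter> space (p \<Otimes>\<^sub>M \<mu>)"
    have A: "?A \<in> sets (p \<Otimes>\<^sub>M \<mu>)" by measurable
    have slice: "Pair l -` ?A = w l -` B" for l
      by (auto simp: space_pair_measure space)
    have "emeasure ?D B = emeasure (p \<Otimes>\<^sub>M \<mu>) ?A"
      by (rule emeasure_distr) measurable
    also have "\<dots> = (\<integral>\<^sup>+ l. emeasure \<mu> (w l -` B) \<partial>p)"
      unfolding emeasure_pair_measure_alt[OF A] slice ..
    finally show "emeasure ?D B = (\<integral>\<^sup>+ l. emeasure \<mu> (w l -` B) \<partial>p)" .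
  qed auto
  finally show ?thesis by simp
qed

lemma borel_prob_measure_distr:
  assumes "prob_space M" "f \<in> borel_measurable M"
  shows "borel_prob_measure (distr M borel f)"
  using assms prob_space.prob_space_distr[of M f borel] by (simp add: borel_prob_measure_def)

text \<open>
  Fubini's theorem, with the slices of the event over the words.
\<close>

lemma emeasure_distr_word_map:
  assumes "borel_prob_measure \<mu>" and [measurable]: "B \<in> sets borel"
  shows "emeasure (distr (W.S \<Otimes>\<^sub>M \<mu>) borel (\<lambda>(\<sigma>, x). word_map w \<sigma> n x)) B =
    (\<integral>\<^sup>+ \<sigma>. emeasure \<mu> (word_map w \<sigma> n -` B) \<partial>W.S)"
    and "(\<lambda>\<sigma>. emeasure \<mu> (word_map w \<sigma> n -` B)) \<in> borel_measurable W.S"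
proof -
  have sets[measurable_cong]: "sets \<mu> = sets borel"
    using assms by (simp add: borel_prob_measure_def)
  have space: "space \<mu> = UNIV" using sets_eq_imp_space_eq[OF sets] by simp
  interpret prob_space \<mu> using assms by (simp add: borel_prob_measure_def)
  let ?A = "(\<lambda>(\<sigma>, x). word_map w \<sigma> n x) -` B \<inter> space (W.S \<Otimes>\<^sub>M \<mu>)"
  have A: "?A \<in> sets (W.S \<Otimes>\<^sub>M \<mu>)" by measurable
  have slice: "Pair \<sigma> -` ?A = word_map w \<sigma> n -` B" for \<sigma>
    by (auto simp: space_pair_measure space)
  show "emeasure (distr (W.S \<Otimes>\<^sub>M \<mu>) borel (\<lambda>(\<sigma>, x). word_map w \<sigma> n x)) B =
    (\<integral>\<^sup>+ \<sigma>. emeasure \<mu> (word_map w \<sigma> n -` B) \<partial>W.S)"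
    using emeasure_pair_measure_alt[OF A] unfolding slice by (subst emeasure_distr) auto
  show "(\<lambda>\<sigma>. emeasure \<mu> (word_map w \<sigma> n -` B)) \<in> borel_measurable W.S"
    using measurable_emeasure_Pair[OF A] unfolding slice .
qed

text \<open>
  One more application of the transfer operator draws a letter \<open>l\<close> independently of the word drawn so far
  and applies \<open>w l\<close> last. This is the action of the word with \<open>l\<close> prefixed, and prefixing an independent
  letter preserves the law of the random word (\<open>PiM_iter\<close>).
\<close>

lemma transfer_operator_iterate:
  assumes \<mu>: "borel_prob_measure \<mu>"
  shows "(transfer_operator p w ^^ n) \<mu> = distr (W.S \<Otimes>\<^sub>M \<mu>) borel (\<lambda>(\<sigma>, x). word_map w \<sigma> n x)"
proof -
  have sets[measurable_cong]: "sets \<mu> = sets borel"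
    using \<mu> by (simp add: borel_prob_measure_def)
  interpret M: prob_space \<mu> using \<mu> by (simp add: borel_prob_measure_def)
  interpret SM: pair_prob_space W.S \<mu> ..
  let ?D = "\<lambda>n. distr (W.S \<Otimes>\<^sub>M \<mu>) borel (\<lambda>(\<sigma>, x). word_map w \<sigma> n x)"
  have prob_D: "borel_prob_measure (?D n)" for n
    by (rule borel_prob_measure_distr) (auto intro: SM.prob_space_axioms)
  show ?thesis
  proof (induction n)
    case 0
    show ?case
    proof (rule measure_eqI)
      fix B assume "B \<in> sets ((transfer_operator p w ^^ 0) \<mu>)"
      then have "B \<in> sets borel" by (simp add: sets)
      from emeasure_distr_word_map(1)[OF \<mu> this, of 0]
      show "emeasure ((transfer_operator p w ^^ 0) \<mu>) B = emeasure (?D 0) B"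
        using W.emeasure_space_1 by (simp add: vimage_def)
    qed (simp add: sets)
  next
    case (Suc n)
    have "transfer_operator p w (?D n) = ?D (Suc n)"
    proof (rule measure_eqI)
      interpret D: prob_space "?D n" using prob_D by (simp add: borel_prob_measure_def)
      fix B assume "B \<in> sets (transfer_operator p w (?D n))"
      then have B[measurable]: "B \<in> sets borel"
        by (simp add: transfer_operator_eq_distr[OF prob_D])
      have wB: "w l -` B \<in> sets borel" for l
        using measurable_sets[OF borel_measurable_continuous_onI[OF continuous_w] B] by simp
      let ?A = "(\<lambda>(l, x). w l x) -` B \<inter> space (p \<Otimes>\<^sub>M ?D n)"
      have A: "?A \<in> sets (p \<Otimes>\<^sub>M ?D n)" by measurable
      have slice: "Pair l -` ?A = w l -` B" for l
        by (auto simp: space_pair_measure)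
      let ?g = "\<lambda>\<sigma>. emeasure \<mu> (word_map w \<sigma> (Suc n) -` B)"
      have g[measurable]: "?g \<in> borel_measurable W.S"
        by (rule emeasure_distr_word_map(2)[OF \<mu> B])
      have "emeasure (transfer_operator p w (?D n)) B = emeasure (p \<Otimes>\<^sub>M ?D n) ?A"
        unfolding transfer_operator_eq_distr[OF prob_D] by (rule emeasure_distr) measurable
      also have "\<dots> = (\<integral>\<^sup>+ l. emeasure (?D n) (w l -` B) \<partial>p)"
        unfolding D.emeasure_pair_measure_alt[OF A] slice ..
      also have "\<dots> = (\<integral>\<^sup>+ l. \<integral>\<^sup>+ \<sigma>. ?g (case_nat l \<sigma>) \<partial>W.S \<partial>p)"
      proof (rule nn_integral_cong)
        fix l
        have "word_map w \<sigma> n -` (w l -` B) = word_map w (case_nat l \<sigma>) (Suc n) -` B" for \<sigma>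
          by (auto simp: word_map_Suc)
        then show "emeasure (?D n) (w l -` B) = (\<integral>\<^sup>+ \<sigma>. ?g (case_nat l \<sigma>) \<partial>W.S)"
          by (simp add: emeasure_distr_word_map(1)[OF \<mu> wB])
      qed
      also have "\<dots> = (\<integral>\<^sup>+ (l, \<sigma>). ?g (case_nat l \<sigma>) \<partial>(p \<Otimes>\<^sub>M W.S))"
        by (subst W.nn_integral_fst[symmetric]) (auto simp: split_beta')
      also have "\<dots> = (\<integral>\<^sup>+ \<sigma>. ?g \<sigma> \<partial>distr (p \<Otimes>\<^sub>M W.S) W.S (\<lambda>(l, \<sigma>). case_nat l \<sigma>))"
        by (subst nn_integral_distr) (auto simp: split_beta')
      also have "\<dots> = emeasure (?D (Suc n)) B"
        by (simp add: W.PiM_iter emeasure_distr_word_map(1)[OF \<mu> B])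
      finally show "emeasure (transfer_operator p w (?D n)) B = emeasure (?D (Suc n)) B" .
    qed (simp add: transfer_operator_eq_distr[OF prob_D])
    then show ?case by (simp add: Suc)
  qed
qed

section \<open>The invariant measure\<close>

definition code_measure :: "'x measure" where
  "code_measure = distr W.S borel code"

lemma borel_prob_code_measure: "borel_prob_measure code_measure"
  unfolding code_measure_def
  by (rule borel_prob_measure_distr) (auto intro: W.prob_space_axioms)

text \<open>
  The law of \<open>w l (code \<sigma>) = code (case_nat l \<sigma>)\<close> is that of \<open>code \<sigma>\<close>, because \<open>case_nat l \<sigma>\<close> and \<open>\<sigma>\<close>
  have the same law.
\<close>

lemma transfer_operator_code_measure: "transfer_operator p w code_measure = code_measure"
proof -
  interpret N: prob_space code_measure
    using borel_prob_code_measure by (simp add: borel_prob_measure_def)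
  have "p \<Otimes>\<^sub>M code_measure = distr (p \<Otimes>\<^sub>M W.S) (p \<Otimes>\<^sub>M borel) (\<lambda>(l, \<sigma>). (l, code \<sigma>))"
    using pair_measure_distr[of "\<lambda>l. l" p p code W.S borel] N.sigma_finite_measure_axioms
    by (simp add: code_measure_def)
  then have "transfer_operator p w code_measure =
      distr (p \<Otimes>\<^sub>M W.S) borel (\<lambda>(l, \<sigma>). w l (code \<sigma>))"
    by (simp add: transfer_operator_eq_distr[OF borel_prob_code_measure] distr_distr o_def split_beta')
  also have "\<dots> = distr (p \<Otimes>\<^sub>M W.S) borel (code \<circ> (\<lambda>(l, \<sigma>). case_nat l \<sigma>))"
    by (simp add: o_def split_beta' code_case_nat)
  also have "\<dots> = distr (distr (p \<Otimes>\<^sub>M W.S) W.S (\<lambda>(l, \<sigma>). case_nat l \<sigma>)) borel code"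
    by (rule distr_distr[symmetric]) (auto simp: split_beta')
  also have "\<dots> = code_measure" by (simp add: W.PiM_iter code_measure_def)
  finally show ?thesis .
qed

lemma AE_code_measure: "AE x in code_measure. x \<in> K"
  unfolding code_measure_def
  by (subst AE_distr_iff) (auto simp: code_in_K compact_K compact_imp_closed)

lemma supp_code_measure_subset: "supp code_measure \<subseteq> K"
proof
  fix x assume x: "x \<in> supp code_measure"
  have "open (- K)" using compact_K by (simp add: compact_imp_closed open_Compl)
  moreover have "measure code_measure (- K) = 0"
    using \<open>open (- K)\<close> by (simp add: code_measure_def measure_distr code_in_K vimage_def)
  ultimately show "x \<in> K" using x by (auto simp: supp_def)
qed

lemma AE_supp_code_measure: "AE x in code_measure. x \<in> supp code_measure"
proof -
  obtain D where "countable D" "K \<subseteq> closure D"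
    using compact_countable_dense[OF compact_K] by blast
  with AE_code_measure borel_prob_code_measure show ?thesis
    by (intro AE_in_supp[of _ D K]) (auto simp: borel_prob_measure_def prob_space_def)
qed

lemma code_measure_in_measures_M: "code_measure \<in> measures_M"
proof -
  interpret N: prob_space code_measure
    using borel_prob_code_measure by (simp add: borel_prob_measure_def)
  have [measurable_cong]: "sets code_measure = sets borel" by (simp add: code_measure_def)
  have "integrable code_measure f" if f: "f \<in> Lip1" for f
  proof -
    have [measurable]: "f \<in> borel_measurable borel" by (rule Lip1_measurable[OF f])
    obtain r where r: "\<And>x. x \<in> K \<Longrightarrow> dist base x \<le> r"
      using compact_imp_bounded[OF compact_K] bounded_any_center by blast
    have "AE x in code_measure. norm (f x) \<le> \<bar>f base\<bar> + r"
      using AE_code_measure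
    proof eventually_elim
      case (elim x)
      then show ?case
        using r[OF elim] f[unfolded Lip1_iff, rule_format, of base x] by simp
    qed
    then show ?thesis by (rule N.integrable_const_bound) simp
  qed
  moreover have "compact (supp code_measure)"
    using compact_K closed_supp supp_code_measure_subset by (metis compact_Int_closed inf.absorb2)
  moreover have "measure code_measure (supp code_measure) = 1"
    using AE_supp_code_measure borel_closed[OF closed_supp] by (subst N.prob_eq_1) (simp_all add: code_measure_def)
  ultimately show ?thesis
    using borel_prob_code_measure by (simp add: measures_M_def compact_imp_separable_space)
qed

text \<open>
  Both integrals are expectations over pairs of a random word and an independent point with law \<open>\<mu>\<close>; the
  second one does not depend on the point. In this coupling the arguments of \<open>f\<close> differ by at most \<open>e\<close>.
\<close>

lemma integral_iterate_dist_le: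
  assumes \<mu>: "borel_prob_measure \<mu>" and B [measurable]: "B \<in> sets borel"
    and ae: "AE x in \<mu>. x \<in> B"
    and e: "\<And>\<sigma> x. x \<in> B \<Longrightarrow> dist (word_map w \<sigma> n x) (code \<sigma>) \<le> e" and f: "f \<in> Lip1"
  shows "\<bar>(\<integral>x. f x \<partial>(transfer_operator p w ^^ n) \<mu>) - (\<integral>x. f x \<partial>code_measure)\<bar> \<le> e"
proof -
  have sets[measurable_cong]: "sets \<mu> = sets borel"
    using \<mu> by (simp add: borel_prob_measure_def)
  interpret M: prob_space \<mu> using \<mu> by (simp add: borel_prob_measure_def)
  interpret SM: pair_prob_space W.S \<mu> ..
  have [measurable]: "f \<in> borel_measurable borel" by (rule Lip1_measurable[OF f])
  let ?P = "W.S \<Otimes>\<^sub>M \<mu>"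
  let ?g = "\<lambda>z. f (word_map w (fst z) n (snd z))" and ?h = "\<lambda>z. f (code (fst z))"
  have gm[measurable]: "?g \<in> borel_measurable ?P"
    by (rule measurable_compose[OF measurable_word_map_comp]) measurable
  have hm[measurable]: "?h \<in> borel_measurable ?P" by measurable
  have "AE z in ?P. snd z \<in> B"
    using ae by (subst SM.AE_pair_iff[symmetric]) auto
  then have close: "AE z in ?P. \<bar>?g z - ?h z\<bar> \<le> e"
  proof eventually_elim
    case (elim z)
    then show ?case
      using e[OF elim, of "fst z"] f[unfolded Lip1_iff, rule_format]
      by (meson order_trans)
  qed
  obtain r where r: "\<And>x. x \<in> K \<Longrightarrow> dist base x \<le> r"
    using compact_imp_bounded[OF compact_K] bounded_any_center by blast
  have h_bound: "\<bar>?h z\<bar> \<le> \<bar>f base\<bar> + r" for z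
    using r[OF code_in_K, of "fst z"] f[unfolded Lip1_iff, rule_format, of base "code (fst z)"] by simp
  have h: "integrable ?P ?h"
    using h_bound by (intro SM.integrable_const_bound[where B = "\<bar>f base\<bar> + r"]) auto
  have g: "integrable ?P ?g"
  proof (rule SM.integrable_const_bound)
    show "AE z in ?P. norm (?g z) \<le> \<bar>f base\<bar> + r + e"
      using close
    proof eventually_elim
      case (elim z)
      then show ?case using h_bound[of z] by simp
    qed
  qed measurable
  have "(\<integral>x. f x \<partial>(transfer_operator p w ^^ n) \<mu>) = (\<integral>z. ?g z \<partial>?P)"
    by (simp add: transfer_operator_iterate[OF \<mu>] integral_distr split_beta')
  moreover have "(\<integral>x. f x \<partial>code_measure) = (\<integral>z. ?h z \<partial>?P)"
  proof -
    have "(\<integral>x. f x \<partial>code_measure) = (\<integral>\<sigma>. f (code \<sigma>) \<partial>distr ?P W.S fst)"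
      by (simp add: code_measure_def integral_distr M.distr_pair_fst)
    also have "\<dots> = (\<integral>z. ?h z \<partial>?P)" by (subst integral_distr) auto
    finally show ?thesis .
  qed
  ultimately have "\<bar>(\<integral>x. f x \<partial>(transfer_operator p w ^^ n) \<mu>) - (\<integral>x. f x \<partial>code_measure)\<bar>
      = \<bar>\<integral>z. ?g z - ?h z \<partial>?P\<bar>"
    using g h by simp
  also have "\<dots> \<le> (\<integral>z. \<bar>?g z - ?h z\<bar> \<partial>?P)"
    by (rule integral_abs_bound)
  also have "\<dots> \<le> (\<integral>z. e \<partial>?P)"
    using close g h by (intro integral_mono_AE) auto
  also have "\<dots> = e" by (simp add: SM.prob_space)
  finally show ?thesis .
qed

lemma hutchinson_dist_iterate_tendsto:
  assumes \<mu>: "borel_prob_measure \<mu>" and "compact B" "AE x in \<mu>. x \<in> B"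
  shows "(\<lambda>n. hutchinson_dist ((transfer_operator p w ^^ n) \<mu>) code_measure) \<longlonglongrightarrow> 0"
proof (rule LIMSEQ_I)
  fix e :: real assume "e > 0"
  then obtain n0 where n0: "\<And>n \<sigma> x. n \<ge> n0 \<Longrightarrow> x \<in> B \<Longrightarrow> dist (word_map w \<sigma> n x) (code \<sigma>) \<le> e / 2"
    using word_map_uniform_limit[OF \<open>compact B\<close>, of "e / 2"] by auto
  have "norm (hutchinson_dist ((transfer_operator p w ^^ n) \<mu>) code_measure - 0) < e"
    if n: "n \<ge> n0" for n
  proof -
    let ?I = "\<lambda>f. \<bar>(\<integral>x. f x \<partial>(transfer_operator p w ^^ n) \<mu>) - (\<integral>x. f x \<partial>code_measure)\<bar>"
    have le: "?I f \<le> e / 2" if "f \<in> Lip1" for f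
      using integral_iterate_dist_le[OF \<mu> borel_compact[OF \<open>compact B\<close>] assms(3) n0[OF n] that] .
    have zero: "(\<lambda>_. 0) \<in> (Lip1 :: ('x \<Rightarrow> real) set)" by (simp add: Lip1_iff)
    have "(SUP f\<in>Lip1. ?I f) \<le> e / 2" using zero le by (intro cSUP_least) auto
    moreover have "0 \<le> (SUP f\<in>Lip1. ?I f)"
      using zero le by (intro cSUP_upper2[of _ _ "\<lambda>_. 0"] bdd_aboveI2[where M = "e / 2"]) auto
    ultimately show ?thesis using \<open>e > 0\<close> by (simp add: hutchinson_dist_def)
  qed
  then show "\<exists>no. \<forall>n\<ge>no. norm (hutchinson_dist ((transfer_operator p w ^^ n) \<mu>) code_measure - 0) < e"
    by blast
qed

text \<open>
  All iterates of an invariant measure agree with it, so the coupling bound holds for it with every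
  positive \<open>e\<close>.
\<close>

lemma invariant_measure_unique:
  assumes \<mu>: "borel_prob_measure \<mu>" and "compact B" "AE x in \<mu>. x \<in> B"
    and inv: "transfer_operator p w \<mu> = \<mu>"
  shows "\<mu> = code_measure"
proof (rule measure_eqI_Lip1[OF \<mu> borel_prob_code_measure])
  fix f :: "'x \<Rightarrow> real" assume f: "f \<in> Lip1"
  have iter: "(transfer_operator p w ^^ n) \<mu> = \<mu>" for n
    by (induction n) (simp_all add: inv)
  have "\<bar>(\<integral>x. f x \<partial>\<mu>) - (\<integral>x. f x \<partial>code_measure)\<bar> \<le> e" if "e > 0" for e
  proof -
    obtain n where n: "\<And>\<sigma> x. x \<in> B \<Longrightarrow> dist (word_map w \<sigma> n x) (code \<sigma>) \<le> e"
      using word_map_uniform_limit[OF \<open>compact B\<close> \<open>e > 0\<close>] by blast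
    from integral_iterate_dist_le[OF \<mu> borel_compact[OF \<open>compact B\<close>] assms(3) n f] show ?thesis by (simp add: iter)
  qed
  then have "\<bar>(\<integral>x. f x \<partial>\<mu>) - (\<integral>x. f x \<partial>code_measure)\<bar> \<le> 0"
    by (rule field_le_epsilon) simp
  then show "(\<integral>x. f x \<partial>\<mu>) = (\<integral>x. f x \<partial>code_measure)" by simp
qed

text \<open>
  By \<open>K_subset_invariant\<close> it suffices that the support is invariant. If \<open>x\<close> is in the support and \<open>V\<close> is a
  neighbourhood of \<open>w l x\<close>, then \<open>w\<close> maps a box \<open>A \<times> B\<close> around \<open>(l, x)\<close> into \<open>V\<close>; both sides of the box have
  positive measure, and invariance of the measure bounds the measure of \<open>V\<close> below by their product.
\<close>

lemma supp_code_measure_eq: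
  assumes full: "\<forall>U. open U \<and> U \<noteq> {} \<longrightarrow> measure p U > 0"
  shows "supp code_measure = K"
proof
  interpret N: prob_space code_measure
    using borel_prob_code_measure by (simp add: borel_prob_measure_def)
  interpret PN: pair_prob_space p code_measure ..
  have sets[measurable_cong]: "sets code_measure = sets borel" by (simp add: code_measure_def)
  have space: "space code_measure = UNIV" by (simp add: code_measure_def)
  show "K \<subseteq> supp code_measure"
  proof (rule K_subset_invariant[OF closed_supp])
    show "supp code_measure \<noteq> {}"
      using AE_supp_code_measure N.AE_False by auto
  next
    fix l x assume x: "x \<in> supp code_measure"
    show "w l x \<in> supp code_measure"
      unfolding supp_def
    proof (intro CollectI allI impI)
      fix V assume V: "open V \<and> w l x \<in> V"
      have "open ((\<lambda>(l, x). w l x) -` V)"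
        using IFS V by (simp add: IFS_def continuous_on_open_vimage)
      moreover have "(l, x) \<in> (\<lambda>(l, x). w l x) -` V" using V by simp
      ultimately obtain A B where AB: "open A" "open B" "(l, x) \<in> A \<times> B"
          "A \<times> B \<subseteq> (\<lambda>(l, x). w l x) -` V"
        using open_prod_elim by metis
      have [measurable]: "V \<in> sets borel" using V by simp
      have "0 < measure p A * measure code_measure B"
        using AB full x by (intro mult_pos_pos) (auto simp: supp_def)
      also have "\<dots> = measure (p \<Otimes>\<^sub>M code_measure) (A \<times> B)"
        using AB(1,2) by (simp add: measure_def N.emeasure_pair_measure_Times sets enn2real_mult)
      also have "\<dots> \<le> measure (p \<Otimes>\<^sub>M code_measure)
          ((\<lambda>(l, x). w l x) -` V \<inter> space (p \<Otimes>\<^sub>M code_measure))"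
      proof (rule PN.finite_measure_mono)
        show "A \<times> B \<subseteq> (\<lambda>(l, x). w l x) -` V \<inter> space (p \<Otimes>\<^sub>M code_measure)"
          using AB(4) by (auto simp: space_pair_measure space)
      qed measurable
      also have "\<dots> = measure (transfer_operator p w code_measure) V"
        by (simp add: transfer_operator_eq_distr[OF borel_prob_code_measure] measure_distr)
      finally show "0 < measure code_measure V"
        by (simp add: transfer_operator_code_measure)
    qed
  qed
qed (rule supp_code_measure_subset)

end

theorem theorem5:
  fixes w :: "'l::metric_space \<Rightarrow> 'x::complete_space \<Rightarrow> 'x"
    and p :: "'l measure"
    and K :: "'x set"
  assumes "\<forall>\<epsilon>>0. uniformly_chainable_on_balls (UNIV :: 'x set) dist \<epsilon>"
    and "\<forall>\<epsilon>>0. chainable (nonempty_compacts :: 'x set set) hausdorff_dist \<epsilon>"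
    and "compact (UNIV :: 'l set)"
    and "borel_prob_measure p"
    and "IFS w"
    and "weakly_star_hyperbolic w"
    and "global_attractor w K"
  shows "\<exists>\<nu>. \<nu> \<in> measures_M \<and> transfer_operator p w \<nu> = \<nu> \<and> supp \<nu> \<subseteq> K \<and>
           (\<forall>\<nu>'\<in>measures_M. transfer_operator p w \<nu>' = \<nu>' \<and> supp \<nu>' \<subseteq> K \<longrightarrow> \<nu>' = \<nu>) \<and>
           ((\<forall>U. open U \<and> U \<noteq> {} \<longrightarrow> measure p U > 0) \<longrightarrow> supp \<nu> = K) \<and>
           (\<forall>\<mu>\<in>measures_M. compact (supp \<mu>) \<longrightarrow>
              (\<lambda>n. hutchinson_dist ((transfer_operator p w ^^ n) \<mu>) \<nu>) \<longlonglongrightarrow> 0)"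
proof -
  interpret random_ifs w K p
    using assms by unfold_locales auto
  have unique: "\<nu>' = code_measure"
    if \<nu>': "\<nu>' \<in> measures_M" "transfer_operator p w \<nu>' = \<nu>'" "supp \<nu>' \<subseteq> K" for \<nu>'
  proof (rule invariant_measure_unique[OF _ compact_K _ \<nu>'(2)])
    show "borel_prob_measure \<nu>'" using \<nu>'(1) by (simp add: measures_M_def)
    show "AE x in \<nu>'. x \<in> K" using AE_in_supp_measures_M[OF \<nu>'(1)] \<nu>'(3) by auto
  qed
  have convergence: "(\<lambda>n. hutchinson_dist ((transfer_operator p w ^^ n) \<mu>) code_measure) \<longlonglongrightarrow> 0"
    if "\<mu> \<in> measures_M" "compact (supp \<mu>)" for \<mu>
    using that AE_in_supp_measures_M[OF that(1)]
    by (intro hutchinson_dist_iterate_tendsto[of _ "supp \<mu>"]) (auto simp: measures_M_def)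
  show ?thesis
    using code_measure_in_measures_M transfer_operator_code_measure supp_code_measure_subset
      supp_code_measure_eq unique convergence
    by (intro exI[of _ code_measure]) blast
qed

end
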